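(* For the one-dimensional Euler equations under a gravitational potential $\phi(x)$ with the ideal equation of state, the modified semi-discrete CDG schemes (on primal and dual meshes) are well-balanced for a general stationary hydrostatic solution. That is, for any stationary hydrostatic solution $(\rho^s,0,p^s)$ with $(p^s)_x=-\rho^s\phi_x$, and with $\mathbf U_h^{s,C},\mathbf U_h^{s,D}$ the projections of $\mathbf U^s=(\rho^s,0,p^s/(\gamma-1))^\top$, $$\mathbf L_h^C(\mathbf U_h^{s,C},\mathbf U_h^{s,D})=\mathbf 0,\qquad \mathbf L_h^D(\mathbf U_h^{s,D},\mathbf U_h^{s,C})=\mathbf 0 .$$
   Context: **Equations.** $\mathbf U_t+\mathbf F(\mathbf U)_x=\mathbf S(\mathbf U,\phi_x)$ with $\mathbf U=(\rho,m,E)^\top$, $m=\rho u$, $\mathbf F(\mathbf U)=(\rho u,\rho u^2+p,(E+p)u)^\top$, $\mathbf S=(0,-\rho\phi_x,-m\phi_x)^\top$, $p=(\gamma-1)(E-\frac{m^2}{2\rho})$, $\gamma>1$ constant. A stationary hydrostatic solution is $\rho^s(x)>0$, $u^s=0$, $p^s(x)>0$ with $(p^s)_x=-\rho^s\phi_x$. **Meshes and spaces.** Uniform grid with step $\Delta x$: points $x_r$ with $r$ integer or half-integer, $x_{r+\frac12}-x_r=\Delta x/2$. For $r$ integer or half-integer put $I_r=(x_{r-\frac12},x_{r+\frac12})$, $I_r^-=(x_{r-\frac12},x_r)$, $I_r^+=(x_r,x_{r+\frac12})$. The cells $I_j$ ($j$ integer) form the primal mesh (label $C$), the cells $I_{j+\frac12}$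 form the dual mesh (label $D$). $\mathbb V_h^{C,k}$ and $\mathbb V_h^{D,k}$ are the spaces of functions that are polynomials of degree at most $k$ on each primal, respectively dual, cell; $k\ge1$. All statements "for all $r$" range over those cells $I_r$ for which both overlapping cells $I_{r\pm\frac12}$ of the other mesh are present (boundary treatment is not part of the statement). For a cell $I_r$ write $(A,B)=(C,D)$ if $r$ is an integer and $(A,B)=(D,C)$ if $r$ is a half-integer. $\overline{(g)}_r=\frac1{\Delta x}\int_{I_r}g\,dx$ denotes the cell average, and $f(x^\pm)$ are one-sided limits. **Projection.** $\mathcal P_h^A(f)$ is the function in $\mathbb V_h^{A,k}$ determined on each cell $I_r$ of mesh $A$ by $\int_{I_r^-}\mathcal P_h^A(f)dx=\int_{I_r^-}f\,dx$ and $\int_{I_r}\mathcal P_h^A(f)v\,dx=\int_{I_r}f v\,dx$ for all $v\in\mathrm{span}\{\Phi_0,\Phi_2,\dots,\Phi_k\}$, where $\Phi_0=1,\Phi_1=\xi,\Phi_2=\xi^2-\frac13,\dots$ are the monic Legendre polynomials in $\xi=2(x-x_r)/\Delta x$. $\mathbf U_h^{s,A}$ is the componentwise projection of $\mathbf U^s=(\rho^s,0,p^s/(\gamma-1))^\top$, and $\rho_h^{s,A}=\mathcal P_h^A(\rho^s)$, $p_h^{s,A}=\mathcal P_h^A(p^s)$. It is assumed that $\rho_h^{s,C},\rho_h^{s,D}$ are positive at all points where the schemes below evaluate them, and that their cell averages appearing below are positive (so the schemes are well defined). **Quadrature.** $\{x_r^{1,\alpha}\}_{\alpha=1}^N$ and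 $\{x_r^{2,\alpha}\}_{\alpha=1}^N$ are the $N$-point Gauss nodes in $I_r^-$ and $I_r^+$, with weights $\omega_\alpha$, $\sum_\alpha\omega_\alpha=1$, $N\ge k+1$. **Source discretization.** With $\mathbf Q=(0,\rho,m)^\top$, for a test polynomial $v$ on $I_r$, $$\langle\mathbf S_h^B,v\rangle_r=\frac{\overline{(\mathbf Q_h^B)}_r}{\overline{(\rho_h^{s,B})}_r}\Big(p_h^{s,B}(x_{r+\frac12})v(x_{r+\frac12}^-)-p_h^{s,B}(x_{r-\frac12})v(x_{r-\frac12}^+)\Big)$$ $$+\frac{\Delta x}2\sum_{\kappa=1}^2\sum_{\alpha=1}^N\omega_\alpha\Big[\Big(\frac{\mathbf Q_h^B}{\rho_h^{s,B}}(x_r^{\kappa,\alpha})-\frac{\overline{(\mathbf Q_h^B)}_r}{\overline{(\rho_h^{s,B})}_r}\Big)\big((p_h^{s,B})_xv\big)(x_r^{\kappa,\alpha})-\frac{\overline{(\mathbf Q_h^B)}_r}{\overline{(\rho_h^{s,B})}_r}\big(p_h^{s,B}v_x\big)(x_r^{\kappa,\alpha})\Big].$$ **Scheme.** For $\mathbf U_h^C\in[\mathbb V_h^{C,k}]^3$, $\mathbf U_h^D\in[\mathbb V_h^{D,k}]^3$ and $\tau_{max}>0$, the operator $\mathbf L_h^A(\mathbf U_h^A,\mathbf U_h^B)\in[\mathbb V_h^{A,k}]^3$ is defined by: for every cell $I_r$ of mesh $A$ and every $v\in\mathbb P^k(I_r)$, $$\int_{I_r}\mathbf L_h^A(\mathbf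 U_h^A,\mathbf U_h^B)v\,dx=\frac1{\tau_{max}}\int_{I_r}(\mathbf U_h^B-\mathbf U_h^A)v\,dx+\frac1{\tau_{max}}\int_{I_r}(\mathbf U_h^{s,A}-\mathbf U_h^{s,B})v\,dx$$ $$-\Big(\mathbf F(\mathbf U_h^B(x_{r+\frac12}))v(x_{r+\frac12}^-)-\mathbf F(\mathbf U_h^B(x_{r-\frac12}))v(x_{r-\frac12}^+)\Big)+\frac{\Delta x}2\sum_{\kappa=1}^2\sum_{\alpha=1}^N\omega_\alpha\mathbf F(\mathbf U_h^B(x_r^{\kappa,\alpha}))v_x(x_r^{\kappa,\alpha})+\langle\mathbf S_h^B,v\rangle_r .$$ The semi-discrete schemes are $\frac{d}{dt}\mathbf U_h^C=\mathbf L_h^C(\mathbf U_h^C,\mathbf U_h^D)$, $\frac{d}{dt}\mathbf U_h^D=\mathbf L_h^D(\mathbf U_h^D,\mathbf U_h^C)$. They are called well-balanced for $\mathbf U^s$ if $\mathbf L_h^C(\mathbf U_h^{s,C},\mathbf U_h^{s,D})=\mathbf 0$ and $\mathbf L_h^D(\mathbf U_h^{s,D},\mathbf U_h^{s,C})=\mathbf 0$. *)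

theory Defs
  imports "HOL-Analysis.Analysis" "HOL-Computational_Algebra.Polynomial"
begin

section \<open>Overlapping uniform meshes\<close>

text \<open>
  Grid points and cells are indexed by the doubled index \<open>i = 2 r\<close>, so that integer and
  half-integer \<open>r\<close> become even and odd \<open>i\<close>. The points \<open>x\<^bsub>r-1/2\<^esub>, x\<^bsub>r\<^esub>, x\<^bsub>r+1/2\<^esub>\<close> are
  \<open>gpt x0 h (i - 1)\<close>, \<open>gpt x0 h i\<close>, \<open>gpt x0 h (i + 1)\<close>; the step \<open>\<Delta>x\<close> is \<open>h\<close> and \<open>x0\<close> is the point
  of index 0.
\<close>

definition gpt :: "real \<Rightarrow> real \<Rightarrow> int \<Rightarrow> real" where
  "gpt x0 h i = x0 + of_int i * (h / 2)"

definition cell :: "real \<Rightarrow> real \<Rightarrow> int \<Rightarrow> real set" where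
  "cell x0 h i = {gpt x0 h (i - 1) <..< gpt x0 h (i + 1)}"

definition left_half :: "real \<Rightarrow> real \<Rightarrow> int \<Rightarrow> real set" where
  "left_half x0 h i = {gpt x0 h (i - 1) <..< gpt x0 h i}"

datatype mesh = Primal | Dual

fun other :: "mesh \<Rightarrow> mesh" where
  "other Primal = Dual"
| "other Dual = Primal"

text \<open>\<open>J\<close> is the set of doubled indices of all cells (of both meshes) that are present.\<close>

fun mesh_cells :: "int set \<Rightarrow> mesh \<Rightarrow> int set" where
  "mesh_cells J Primal = {i \<in> J. even i}"
| "mesh_cells J Dual = {i \<in> J. odd i}"

text \<open>Cells for which both overlapping cells of the other mesh are present.\<close>

definition inner_cells :: "int set \<Rightarrow> mesh \<Rightarrow> int set" where
  "inner_cells J A = {i \<in> mesh_cells J A. i - 1 \<in> J \<and> i + 1 \<in> J}"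

definition mesh_domain :: "real \<Rightarrow> real \<Rightarrow> int set \<Rightarrow> real set" where
  "mesh_domain x0 h J = interior (\<Union>i\<in>J. {gpt x0 h (i - 1) .. gpt x0 h (i + 1)})"

definition cell_avg :: "real \<Rightarrow> real \<Rightarrow> int \<Rightarrow> (real \<Rightarrow> 'a::euclidean_space) \<Rightarrow> 'a" where
  "cell_avg x0 h i g = (1 / h) *\<^sub>R integral (cell x0 h i) g"


section \<open>Piecewise polynomial spaces and the projection\<close>

text \<open>
  Functions that are polynomials of degree at most \<open>k\<close> on each (open) cell with index in \<open>S\<close>.
  Values at cell interfaces and outside the mesh carry no meaning; they are fixed to 0, so that an
  element of the space is determined by its restrictions to the cells.
\<close>

definition pw_poly :: "real \<Rightarrow> real \<Rightarrow> int set \<Rightarrow> nat \<Rightarrow> (real \<Rightarrow> real) set" where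
  "pw_poly x0 h S k =
     {f. (\<forall>i\<in>S. \<exists>q::real poly. degree q \<le> k \<and> (\<forall>x\<in>cell x0 h i. f x = poly q x)) \<and>
         (\<forall>x. x \<notin> (\<Union>i\<in>S. cell x0 h i) \<longrightarrow> f x = 0)}"

text \<open>Monic Legendre polynomials on \<open>[-1, 1]\<close>, by Rodrigues' formula.\<close>

definition legendre :: "nat \<Rightarrow> real poly" where
  "legendre n = smult (fact n / fact (2 * n)) ((pderiv ^^ n) ([:-1, 0, 1:] ^ n))"

text \<open>The span of all Legendre polynomials of degree at most \<open>k\<close> except the linear one.\<close>

definition proj_tests :: "nat \<Rightarrow> real poly set" where
  "proj_tests k = {\<Sum>l\<in>{..k} - {1}. smult (c l) (legendre l) | c. True}"

definition proj :: "real \<Rightarrow> real \<Rightarrow> int set \<Rightarrow> nat \<Rightarrow> mesh \<Rightarrow> (real \<Rightarrow> real) \<Rightarrow> real \<Rightarrow> real" where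
  "proj x0 h J k A f =
     (THE g. g \<in> pw_poly x0 h (mesh_cells J A) k \<and>
        (\<forall>i\<in>mesh_cells J A.
           integral (left_half x0 h i) g = integral (left_half x0 h i) f \<and>
           (\<forall>v\<in>proj_tests k.
              integral (cell x0 h i) (\<lambda>x. g x * poly v (2 * (x - gpt x0 h i) / h)) =
              integral (cell x0 h i) (\<lambda>x. f x * poly v (2 * (x - gpt x0 h i) / h)))))"

definition proj_vec ::
  "real \<Rightarrow> real \<Rightarrow> int set \<Rightarrow> nat \<Rightarrow> mesh \<Rightarrow> (real \<Rightarrow> real^3) \<Rightarrow> real \<Rightarrow> real^3" where
  "proj_vec x0 h J k A U x = (\<chi> c. proj x0 h J k A (\<lambda>y. U y $ c) x)"


section \<open>Gauss quadrature\<close>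

definition gauss_nodes :: "nat \<Rightarrow> real set" where
  "gauss_nodes N = {z. poly (legendre N) z = 0}"

text \<open>
  Interpolatory weights, normalised to sum 1 (hence the factor 1/2 for the interval \<open>[-1, 1]\<close>).
  The node set serves as the index set of the rule.
\<close>

definition gauss_weight :: "nat \<Rightarrow> real \<Rightarrow> real" where
  "gauss_weight N z =
     1 / 2 * integral {-1..1} (\<lambda>s. \<Prod>y\<in>gauss_nodes N - {z}. (s - y) / (z - y))"

text \<open>
  The reference node \<open>z\<close> transported to the left (\<open>\<kappa> = 1\<close>) or right (\<open>\<kappa> = 2\<close>) half of a cell;
  the halves have midpoints at distance \<open>h / 4\<close> from the cell centre and half-length \<open>h / 4\<close>.
\<close>

definition quad_pt :: "real \<Rightarrow> real \<Rightarrow> int \<Rightarrow> nat \<Rightarrow> real \<Rightarrow> real" where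
  "quad_pt x0 h i \<kappa> z = gpt x0 h i + (if \<kappa> = 1 then - h / 4 else h / 4) + h / 4 * z"

definition quad ::
  "real \<Rightarrow> real \<Rightarrow> nat \<Rightarrow> int \<Rightarrow> (real \<Rightarrow> 'a::real_vector) \<Rightarrow> 'a" where
  "quad x0 h N i g =
     (h / 2) *\<^sub>R (\<Sum>\<kappa>\<in>{1, 2}. \<Sum>z\<in>gauss_nodes N. gauss_weight N z *\<^sub>R g (quad_pt x0 h i \<kappa> z))"

text \<open>The points at which the scheme on cell \<open>i\<close> evaluates functions of the other mesh.\<close>

definition eval_pts :: "real \<Rightarrow> real \<Rightarrow> nat \<Rightarrow> int \<Rightarrow> real set" where
  "eval_pts x0 h N i =
     {gpt x0 h (i - 1), gpt x0 h (i + 1)} \<union>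
     {quad_pt x0 h i \<kappa> z | \<kappa> z. \<kappa> \<in> {1, 2} \<and> z \<in> gauss_nodes N}"


section \<open>Euler equations with gravity\<close>

text \<open>States are \<open>U = (\<rho>, m, E)\<close> with \<open>m = \<rho> u\<close>.\<close>

definition velocity :: "real^3 \<Rightarrow> real" where
  "velocity U = U $ 2 / U $ 1"

definition pressure :: "real \<Rightarrow> real^3 \<Rightarrow> real" where
  "pressure \<gamma> U = (\<gamma> - 1) * (U $ 3 - (U $ 2)\<^sup>2 / (2 * U $ 1))"

definition flux :: "real \<Rightarrow> real^3 \<Rightarrow> real^3" where
  "flux \<gamma> U = vector [U $ 1 * velocity U,
                      U $ 1 * (velocity U)\<^sup>2 + pressure \<gamma> U,
                      (U $ 3 + pressure \<gamma> U) * velocity U]"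

definition Qvec :: "real^3 \<Rightarrow> real^3" where
  "Qvec U = vector [0, U $ 1, U $ 2]"

definition hydrostatic ::
  "real set \<Rightarrow> (real \<Rightarrow> real) \<Rightarrow> (real \<Rightarrow> real) \<Rightarrow> (real \<Rightarrow> real) \<Rightarrow> bool" where
  "hydrostatic \<Omega> \<phi> \<rho>s ps \<longleftrightarrow>
     (\<forall>x\<in>\<Omega>. \<rho>s x > 0 \<and> ps x > 0 \<and> \<phi> differentiable (at x) \<and>
        (ps has_real_derivative - \<rho>s x * deriv \<phi> x) (at x))"

definition steady_state ::
  "real \<Rightarrow> (real \<Rightarrow> real) \<Rightarrow> (real \<Rightarrow> real) \<Rightarrow> real \<Rightarrow> real^3" where
  "steady_state \<gamma> \<rho>s ps x = vector [\<rho>s x, 0, ps x / (\<gamma> - 1)]"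


section \<open>The modified central DG scheme\<close>

text \<open>
  \<open>rB\<close> and \<open>pB\<close> are the projections of the stationary density and pressure to the mesh of \<open>UB\<close>.
  A test polynomial \<open>v\<close> on a cell extends continuously to its end points, so its one-sided limits
  there are plain values of \<open>poly v\<close>.
\<close>

definition source ::
  "real \<Rightarrow> real \<Rightarrow> nat \<Rightarrow> (real \<Rightarrow> real) \<Rightarrow> (real \<Rightarrow> real) \<Rightarrow> (real \<Rightarrow> real^3) \<Rightarrow>
   int \<Rightarrow> real poly \<Rightarrow> real^3" where
  "source x0 h N rB pB UB i v =
     (let q = (1 / cell_avg x0 h i rB) *\<^sub>R cell_avg x0 h i (\<lambda>x. Qvec (UB x));
          xl = gpt x0 h (i - 1);
          xr = gpt x0 h (i + 1)
      in (pB xr * poly v xr - pB xl * poly v xl) *\<^sub>R q +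
         quad x0 h N i (\<lambda>x. (deriv pB x * poly v x) *\<^sub>R ((1 / rB x) *\<^sub>R Qvec (UB x) - q)
                            - (pB x * poly (pderiv v) x) *\<^sub>R q))"

text \<open>The right-hand side of the scheme on cell \<open>i\<close>, tested with \<open>v\<close>.\<close>

definition cdg_rhs ::
  "real \<Rightarrow> real \<Rightarrow> int set \<Rightarrow> nat \<Rightarrow> nat \<Rightarrow> real \<Rightarrow> real \<Rightarrow> (real \<Rightarrow> real) \<Rightarrow> (real \<Rightarrow> real) \<Rightarrow>
   mesh \<Rightarrow> (real \<Rightarrow> real^3) \<Rightarrow> (real \<Rightarrow> real^3) \<Rightarrow> int \<Rightarrow> real poly \<Rightarrow> real^3" where
  "cdg_rhs x0 h J k N \<gamma> \<tau> \<rho>s ps A UA UB i v =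
     (let UsA = proj_vec x0 h J k A (steady_state \<gamma> \<rho>s ps);
          UsB = proj_vec x0 h J k (other A) (steady_state \<gamma> \<rho>s ps);
          xl = gpt x0 h (i - 1);
          xr = gpt x0 h (i + 1)
      in (1 / \<tau>) *\<^sub>R integral (cell x0 h i) (\<lambda>x. poly v x *\<^sub>R (UB x - UA x))
       + (1 / \<tau>) *\<^sub>R integral (cell x0 h i) (\<lambda>x. poly v x *\<^sub>R (UsA x - UsB x))
       - (poly v xr *\<^sub>R flux \<gamma> (UB xr) - poly v xl *\<^sub>R flux \<gamma> (UB xl))
       + quad x0 h N i (\<lambda>x. poly (pderiv v) x *\<^sub>R flux \<gamma> (UB x))
       + source x0 h N (proj x0 h J k (other A) \<rho>s) (proj x0 h J k (other A) ps) UB i v)"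

definition cdg_op ::
  "real \<Rightarrow> real \<Rightarrow> int set \<Rightarrow> nat \<Rightarrow> nat \<Rightarrow> real \<Rightarrow> real \<Rightarrow> (real \<Rightarrow> real) \<Rightarrow> (real \<Rightarrow> real) \<Rightarrow>
   mesh \<Rightarrow> (real \<Rightarrow> real^3) \<Rightarrow> (real \<Rightarrow> real^3) \<Rightarrow> real \<Rightarrow> real^3" where
  "cdg_op x0 h J k N \<gamma> \<tau> \<rho>s ps A UA UB =
     (THE G. (\<forall>c. (\<lambda>x. G x $ c) \<in> pw_poly x0 h (inner_cells J A) k) \<and>
        (\<forall>i\<in>inner_cells J A. \<forall>v::real poly. degree v \<le> k \<longrightarrow>
           integral (cell x0 h i) (\<lambda>x. poly v x *\<^sub>R G x) =
           cdg_rhs x0 h J k N \<gamma> \<tau> \<rho>s ps A UA UB i v))"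

definition well_balanced ::
  "real \<Rightarrow> real \<Rightarrow> int set \<Rightarrow> nat \<Rightarrow> nat \<Rightarrow> real \<Rightarrow> real \<Rightarrow> (real \<Rightarrow> real) \<Rightarrow> (real \<Rightarrow> real) \<Rightarrow> bool"
  where
  "well_balanced x0 h J k N \<gamma> \<tau> \<rho>s ps \<longleftrightarrow>
     (let UsC = proj_vec x0 h J k Primal (steady_state \<gamma> \<rho>s ps);
          UsD = proj_vec x0 h J k Dual (steady_state \<gamma> \<rho>s ps)
      in cdg_op x0 h J k N \<gamma> \<tau> \<rho>s ps Primal UsC UsD = (\<lambda>x. 0) \<and>
         cdg_op x0 h J k N \<gamma> \<tau> \<rho>s ps Dual UsD UsC = (\<lambda>x. 0))"

end

theory Submission
  imports Defs
begin

text \<open>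
  At rest the momentum equation reads \<open>p\<^sub>x = - \<rho> \<phi>\<^sub>x\<close>, and the scheme is built so that it sees this
  balance as an algebraic identity. Let \<open>\<rho>\<close> and \<open>p\<close> be the projected stationary density and pressure
  on the opposite mesh. If the projected state is \<open>(\<rho>, 0, p / (\<gamma> - 1))\<close>, then its velocity is 0 and
  its pressure is exactly \<open>p\<close>, so the flux is \<open>(0, p, 0)\<close>. In the source, the ratio of \<open>(0, \<rho>, 0)\<close> to
  \<open>\<rho>\<close> is \<open>(0, 1, 0)\<close> at every node and also for the cell averages. The source therefore consists of
  boundary and quadrature terms for \<open>p\<close> that are the negatives of the flux terms, and the
  relaxation terms cancel since the solution is the reference state. The cancellation takes place
  node by node (\<open>cdg_rhs_steady_eq_0\<close>).

  It remains to see that the projected state has the stated form, i.e. that projecting 0 gives 0 and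
  projecting \<open>p\<^sup>s / (\<gamma> - 1)\<close> gives \<open>p / (\<gamma> - 1)\<close>. This is immediate from the defining conditions as
  soon as these have a unique solution (\<open>proj_well_posed\<close>). Solvability is a question on the reference
  interval: by Rodrigues' formula and integration by parts the Legendre polynomials are orthogonal,
  so the moments determine all coefficients but the linear one, which the integral over the left half
  determines (\<open>reference_unisolvence\<close>). The stationary pressure is positive and integrable on a cell,
  hence absolutely integrable, and so has moments against all polynomials.

  Finally, the operator is the function whose tested values are the right-hand side. As the latter
  is 0, so is the former, because a piecewise polynomial can be tested against itself
  (\<open>vector_pw_poly_eq_0\<close>).
\<close>

section \<open>Integrals of polynomials\<close>

definition poly_integral :: "real \<Rightarrow> real \<Rightarrow> real poly \<Rightarrow> real" where
  "poly_integral a b p = integral {a..b} (poly p)"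

lemma poly_integrable: "poly p integrable_on {a..b::real}"
  by (intro integrable_continuous_real continuous_intros)

lemma poly_integral_add: "poly_integral a b (p + q) = poly_integral a b p + poly_integral a b q"
  unfolding poly_integral_def poly_add by (rule integral_add) (rule poly_integrable)+

lemma poly_integral_smult: "poly_integral a b (smult c p) = c * poly_integral a b p"
  unfolding poly_integral_def poly_smult by simp

lemma poly_integral_0 [simp]: "poly_integral a b 0 = 0"
  using poly_integral_smult [of a b 0 0] by simp

lemma poly_integral_sum: "poly_integral a b (\<Sum>l\<in>S. f l) = (\<Sum>l\<in>S. poly_integral a b (f l))"
  by (induction S rule: infinite_finite_induct) (auto simp: poly_integral_add)

lemma poly_integral_pderiv:
  assumes "a \<le> b"
  shows "poly_integral a b (pderiv p) = poly p b - poly p a"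
  unfolding poly_integral_def
  by (intro integral_unique fundamental_theorem_of_calculus assms)
     (auto simp: has_real_derivative_iff_has_vector_derivative [symmetric]
           intro: DERIV_subset [OF poly_DERIV])

lemma poly_integral_square_eq_0:
  assumes "a < b" "poly_integral a b (p * p) = 0"
  shows "p = 0"
proof -
  have "poly (p * p) x = 0" if "x \<in> cbox a b" for x
  proof (rule has_integral_0_cbox_imp_0 [OF _ _ _ _ that])
    show "(poly (p * p) has_integral 0) (cbox a b)"
      using assms(2) poly_integrable [of "p * p" a b]
      by (simp add: poly_integral_def has_integral_iff)
    show "box a b \<noteq> {}" using assms(1) by simp
  qed (auto intro!: continuous_intros)
  then have "{a..b} \<subseteq> {x. poly p x = 0}" by auto
  with assms(1) show ?thesis
    using poly_roots_finite [of p] infinite_Icc [of a b] finite_subset by metis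
qed

section \<open>Legendre polynomials\<close>

lemma power_dvd_pderiv:
  fixes q p :: "real poly"
  assumes "q ^ Suc m dvd p"
  shows "q ^ m dvd pderiv p"
proof -
  obtain r where "p = q ^ Suc m * r" using assms by (elim dvdE)
  then have "pderiv p = q ^ m * (q * pderiv r + r * smult (of_nat (Suc m)) (pderiv q))"
    by (simp only: pderiv_mult pderiv_power_Suc) (simp add: algebra_simps)
  then show ?thesis by simp
qed

lemma power_dvd_higher_pderiv:
  fixes q :: "real poly"
  shows "j \<le> n \<Longrightarrow> q ^ (n - j) dvd (pderiv ^^ j) (q ^ n)"
proof (induction j)
  case (Suc j)
  then have "q ^ Suc (n - Suc j) dvd (pderiv ^^ j) (q ^ n)"
    by (simp add: Suc_diff_Suc del: power_Suc)
  then show ?case using power_dvd_pderiv by simp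
qed simp

text \<open>
  Each integration by parts moves one derivative from \<open>(\<xi>\<^sup>2 - 1)\<^sup>n\<close> to \<open>q\<close>. The boundary terms vanish
  because \<open>\<plusminus>1\<close> are roots of order \<open>n\<close>, so that fewer than \<open>n\<close> derivatives leave the factor
  \<open>\<xi>\<^sup>2 - 1\<close>; and \<open>q\<close> runs out of derivatives before \<open>(\<xi>\<^sup>2 - 1)\<^sup>n\<close> does.
\<close>

lemma poly_integral_higher_pderiv_eq_0:
  assumes "j \<le> n" "degree q < j"
  shows "poly_integral (-1) 1 (q * (pderiv ^^ j) ([:-1, 0, 1:] ^ n)) = 0"
  using assms
proof (induction j arbitrary: q)
  case (Suc j)
  define w where "w = (pderiv ^^ j) ([:-1, 0, 1:] ^ n :: real poly)"
  have "[:-1, 0, 1:] dvd ([:-1, 0, 1:] ^ (n - j) :: real poly)"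
    using Suc.prems by (intro dvd_power) auto
  also have "\<dots> dvd w"
    unfolding w_def using Suc.prems(1) by (intro power_dvd_higher_pderiv) simp
  finally obtain r where r: "w = [:-1, 0, 1:] * r" by (elim dvdE)
  have "poly_integral (-1) 1 (pderiv (q * w)) = 0"
    by (simp add: poly_integral_pderiv r)
  then have "poly_integral (-1) 1 (q * pderiv w) = - poly_integral (-1) 1 (pderiv q * w)"
    by (simp add: pderiv_mult poly_integral_add mult.commute [of w])
  also have "poly_integral (-1) 1 (pderiv q * w) = 0"
  proof (cases "degree q = 0")
    case True
    then have "pderiv q = 0" by (simp add: pderiv_eq_0_iff)
    then show ?thesis by simp
  next
    case False
    then show ?thesis
      unfolding w_def using Suc.prems by (intro Suc.IH) (auto simp: degree_pderiv)
  qed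
  finally show ?case by (simp add: w_def)
qed simp

lemma legendre_orthogonal:
  assumes "degree q < n"
  shows "poly_integral (-1) 1 (q * legendre n) = 0"
  using poly_integral_higher_pderiv_eq_0 [of n n q] assms
  by (simp add: legendre_def poly_integral_smult)

lemma degree_higher_pderiv: "degree ((pderiv ^^ j) p) = degree p - j" for p :: "real poly"
  by (induction j) (auto simp: degree_pderiv)

lemma degree_legendre [simp]: "degree (legendre n) = n"
  by (simp add: legendre_def degree_higher_pderiv degree_power_eq)

lemma legendre_nonzero [simp]: "legendre n \<noteq> 0"
proof (cases n)
  case 0
  then show ?thesis by (simp add: legendre_def)
next
  case (Suc m)
  then show ?thesis using degree_legendre [of n] by (metis degree_0 nat.distinct(1))
qed

lemma legendre_1: "legendre 1 = [:0, 1:]"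
  by (simp add: legendre_def pderiv_pCons)

lemma poly_integral_legendre_mult:
  assumes "l \<noteq> n"
  shows "poly_integral (-1) 1 (legendre l * legendre n) = 0"
  using assms legendre_orthogonal [of "legendre l" n] legendre_orthogonal [of "legendre n" l]
  by (auto simp: mult.commute linorder_neq_iff)

lemma poly_integral_legendre_square: "poly_integral (-1) 1 (legendre n * legendre n) \<noteq> 0"
  using poly_integral_square_eq_0 [of "-1" 1 "legendre n"] by auto

text \<open>
  There is one Legendre polynomial of each degree, so cancelling the leading coefficient repeatedly
  reaches 0: they span all polynomials of bounded degree.
\<close>

lemma legendre_expansion:
  assumes "degree p \<le> k"
  obtains a where "p = (\<Sum>l\<le>k. smult (a l) (legendre l))"
  using assms
proof (induction k arbitrary: p thesis)
  case 0
  obtain c d where "legendre 0 = [:c:]" "p = [:d:]"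
    using 0 degree_legendre [of 0] by (metis degree_eq_zeroE le_zero_eq)
  moreover from this have "c \<noteq> 0" using legendre_nonzero [of 0] by auto
  ultimately show ?case using 0(1) [of "\<lambda>_. d / c"] by simp
next
  case (Suc k)
  define c where "c = coeff p (Suc k) / coeff (legendre (Suc k)) (Suc k)"
  have "coeff (legendre (Suc k)) (Suc k) \<noteq> 0"
    using legendre_nonzero [of "Suc k"] degree_legendre [of "Suc k"]
    by (metis leading_coeff_0_iff)
  then have "coeff (p - smult c (legendre (Suc k))) (Suc k) = 0"
    by (simp add: c_def)
  moreover have "degree (p - smult c (legendre (Suc k))) \<le> Suc k"
    by (intro degree_diff_le Suc.prems order.trans [OF degree_smult_le]) simp
  ultimately have "degree (p - smult c (legendre (Suc k))) \<le> k"
    by (intro degree_le) (metis Suc_lessI coeff_eq_0 le_less_trans)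
  then obtain a where a: "p - smult c (legendre (Suc k)) = (\<Sum>l\<le>k. smult (a l) (legendre l))"
    using Suc.IH by blast
  have "p = (\<Sum>l\<le>k. smult (a l) (legendre l)) + smult c (legendre (Suc k))"
    using a by (metis diff_add_cancel)
  also have "\<dots> = (\<Sum>l\<le>Suc k. smult ((a(Suc k := c)) l) (legendre l))"
    by simp
  finally show ?case using Suc.prems(1) by blast
qed

lemma poly_integral_legendre_expansion:
  assumes "m \<le> k"
  shows "poly_integral (-1) 1 ((\<Sum>l\<le>k. smult (a l) (legendre l)) * legendre m)
         = a m * poly_integral (-1) 1 (legendre m * legendre m)"
proof -
  have "poly_integral (-1) 1 ((\<Sum>l\<le>k. smult (a l) (legendre l)) * legendre m)
        = (\<Sum>l\<le>k. a l * poly_integral (-1) 1 (legendre l * legendre m))"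
    by (simp add: sum_distrib_right poly_integral_sum poly_integral_smult)
  also have "\<dots> = (\<Sum>l\<le>k. if l = m then a m * poly_integral (-1) 1 (legendre m * legendre m) else 0)"
    by (intro sum.cong) (auto simp: poly_integral_legendre_mult)
  finally show ?thesis using assms by simp
qed

section \<open>Unisolvence on the reference interval\<close>

lemma poly_integral_half_legendre_1: "poly_integral (-1) 0 (legendre 1) = - 1 / 2"
proof -
  have "poly_integral (-1) 0 (pderiv [:0, 0, 1/2:]) = - 1 / 2"
    by (subst poly_integral_pderiv) simp_all
  moreover have "pderiv [:0, 0, 1/2:] = legendre 1"
    unfolding legendre_1 by (simp add: pderiv_pCons)
  ultimately show ?thesis by (simp only:)
qed

text \<open>
  In the Legendre basis the moments against \<open>\<Phi>\<^sub>0, \<Phi>\<^sub>2, \<dots>, \<Phi>\<^sub>k\<close> are, up to nonzero factors, the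
  coefficients other than the linear one. The integral over \<open>[-1, 0]\<close> then fixes the linear
  coefficient, since \<open>\<Phi>\<^sub>1 = \<xi>\<close> has the nonzero integral \<open>- 1 / 2\<close> there. This is why the projection
  can prescribe the mean over a half cell in place of the first moment.
\<close>

lemma reference_unisolvence:
  assumes "k \<ge> 1"
  shows "\<exists>!p. degree p \<le> k \<and> poly_integral (-1) 0 p = L \<and>
              (\<forall>l\<in>{..k} - {1}. poly_integral (-1) 1 (p * legendre l) = M l)"
proof -
  let ?P = "\<lambda>a. \<Sum>l\<le>k. smult (a l) (legendre l)"
  let ?n = "\<lambda>l. poly_integral (-1) 1 (legendre l * legendre l)"
  define b where "b l = M l / ?n l" for l
  define r where "r = (\<Sum>l\<in>{..k} - {1}. b l * poly_integral (-1) 0 (legendre l))"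
  have deg: "degree (?P a) \<le> k" for a
    by (intro degree_sum_le) (auto intro: order.trans [OF degree_smult_le])
  have half: "poly_integral (-1) 0 (?P a)
              = (\<Sum>l\<in>{..k} - {1}. a l * poly_integral (-1) 0 (legendre l)) - a 1 / 2" for a
    using assms
    by (simp add: poly_integral_sum poly_integral_smult poly_integral_add sum.remove [of "{..k}" 1]
        poly_integral_half_legendre_1 del: One_nat_def)
  have iff: "poly_integral (-1) 0 (?P a) = L \<and> (\<forall>l\<in>{..k} - {1}. poly_integral (-1) 1 (?P a * legendre l) = M l)
     \<longleftrightarrow> (\<forall>l\<in>{..k} - {1}. a l = b l) \<and> a 1 = 2 * (r - L)" for a
  proof -
    have "(\<forall>l\<in>{..k} - {1}. poly_integral (-1) 1 (?P a * legendre l) = M l)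
          \<longleftrightarrow> (\<forall>l\<in>{..k} - {1}. a l = b l)"
      by (intro ball_cong refl)
         (simp add: poly_integral_legendre_expansion b_def poly_integral_legendre_square eq_divide_eq)
    moreover have "poly_integral (-1) 0 (?P a) = L \<longleftrightarrow> a 1 = 2 * (r - L)"
      if "\<forall>l\<in>{..k} - {1}. a l = b l"
    proof -
      have "(\<Sum>l\<in>{..k} - {1}. a l * poly_integral (-1) 0 (legendre l)) = r"
        unfolding r_def using that by (intro sum.cong) auto
      then have "poly_integral (-1) 0 (?P a) = r - a 1 / 2"
        unfolding half by (simp only:)
      then show ?thesis by (auto simp: field_simps)
    qed
    ultimately show ?thesis by blast
  qed
  \<comment> \<open>The linear coefficient \<open>a 1\<close> has to solve \<open>r - a 1 / 2 = L\<close>.\<close>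
  define a where "a = b(1 := 2 * (r - L))"
  show ?thesis
  proof (rule ex1I)
    show "degree (?P a) \<le> k \<and> poly_integral (-1) 0 (?P a) = L \<and>
          (\<forall>l\<in>{..k} - {1}. poly_integral (-1) 1 (?P a * legendre l) = M l)"
      using deg iff [of a] by (simp add: a_def)
  next
    fix p
    assume p: "degree p \<le> k \<and> poly_integral (-1) 0 p = L \<and>
               (\<forall>l\<in>{..k} - {1}. poly_integral (-1) 1 (p * legendre l) = M l)"
    then obtain a' where a': "p = ?P a'" using legendre_expansion by blast
    have "\<forall>l\<in>{..k}. a' l = a l"
      using p iff [of a'] unfolding a' by (auto simp: a_def)
    then show "p = ?P a" unfolding a' by (intro sum.cong) auto
  qed
qed

section \<open>Transport to the cells of a mesh\<close>

definition ref_coord :: "real \<Rightarrow> real \<Rightarrow> int \<Rightarrow> real \<Rightarrow> real" where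
  "ref_coord x0 h i x = 2 * (x - gpt x0 h i) / h"

lemma has_integral_ref_poly:
  assumes "h > 0"
  shows "((\<lambda>x. poly p (ref_coord x0 h i x)) has_integral h / 2 * poly_integral a b p)
           {gpt x0 h i + a * (h / 2) <..< gpt x0 h i + b * (h / 2)}"
proof -
  define c where "c = gpt x0 h i"
  have "(poly p has_integral poly_integral a b p) (cbox a b)"
    unfolding poly_integral_def using poly_integrable by (auto intro: integrable_integral)
  from has_integral_affinity' [OF this, of "2 / h" "- (2 * c / h)"] assms
  have "((\<lambda>x. poly p (2 / h * x - 2 * c / h)) has_integral h / 2 * poly_integral a b p)
          {(a + 2 * c / h) * (h / 2) .. (b + 2 * c / h) * (h / 2)}"
    by (simp add: field_simps)
  moreover have "(\<lambda>x. poly p (2 / h * x - 2 * c / h)) = (\<lambda>x. poly p (ref_coord x0 h i x))"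
    using assms by (simp add: ref_coord_def c_def field_simps)
  moreover have "(a + 2 * c / h) * (h / 2) = c + a * (h / 2)"
                "(b + 2 * c / h) * (h / 2) = c + b * (h / 2)"
    using assms by (simp_all add: field_simps)
  ultimately show ?thesis by (simp only: has_integral_Icc_iff_Ioo c_def)
qed

lemma cell_eq: "cell x0 h i = {gpt x0 h i + (- 1) * (h / 2) <..< gpt x0 h i + 1 * (h / 2)}"
  by (simp add: cell_def gpt_def algebra_simps add_divide_distrib diff_divide_distrib)

lemma left_half_eq:
  "left_half x0 h i = {gpt x0 h i + (- 1) * (h / 2) <..< gpt x0 h i + 0 * (h / 2)}"
  by (simp add: left_half_def gpt_def algebra_simps diff_divide_distrib)

lemma left_half_subset_cell: "h > 0 \<Longrightarrow> left_half x0 h i \<subseteq> cell x0 h i"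
  by (auto simp: left_half_eq cell_eq)

lemmas integral_cell_ref_poly =
  integral_unique [OF has_integral_ref_poly [where a = "-1" and b = 1, folded cell_eq]]

lemmas integral_left_half_ref_poly =
  integral_unique [OF has_integral_ref_poly [where a = "-1" and b = 0, folded left_half_eq]]

text \<open>
  Absolute integrability is what makes moments against polynomials meaningful; without it the
  integrals below could be the default value 0, and would then not be linear in the test polynomial.
\<close>

lemma integrable_mult_ref_poly:
  fixes f :: "real \<Rightarrow> real"
  assumes "f absolutely_integrable_on cell x0 h i"
  shows "(\<lambda>x. f x * poly v (ref_coord x0 h i x)) integrable_on cell x0 h i"
proof -
  let ?v = "\<lambda>x. poly v (ref_coord x0 h i x)"
  have cont: "continuous_on T ?v" for T
    unfolding ref_coord_def divide_inverse by (intro continuous_intros)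
  have "bounded (?v ` {gpt x0 h (i - 1) .. gpt x0 h (i + 1)})"
    by (intro compact_imp_bounded compact_continuous_image cont compact_Icc)
  then have "bounded (?v ` cell x0 h i)"
    by (rule bounded_subset) (auto simp: cell_def)
  moreover have "?v \<in> borel_measurable (lebesgue_on (cell x0 h i))"
    by (intro continuous_imp_measurable_on_sets_lebesgue cont) (simp add: cell_def)
  ultimately have "(\<lambda>x. ?v x * f x) absolutely_integrable_on cell x0 h i"
    by (intro absolutely_integrable_bounded_measurable_product_real assms)
       (simp_all add: cell_def)
  then show ?thesis
    using set_lebesgue_integral_eq_integral(1) by (simp add: mult.commute)
qed

text \<open>
  The conditions that the projection imposes on a single cell: \<open>f\<close> and \<open>g\<close> agree in all the
  functionals by which the projection is determined.
\<close>

definition same_moments ::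
  "real \<Rightarrow> real \<Rightarrow> nat \<Rightarrow> (real \<Rightarrow> real) \<Rightarrow> int \<Rightarrow> (real \<Rightarrow> real) \<Rightarrow> bool" where
  "same_moments x0 h k f i g \<longleftrightarrow>
     integral (left_half x0 h i) g = integral (left_half x0 h i) f \<and>
     (\<forall>v\<in>proj_tests k.
        integral (cell x0 h i) (\<lambda>x. g x * poly v (ref_coord x0 h i x)) =
        integral (cell x0 h i) (\<lambda>x. f x * poly v (ref_coord x0 h i x)))"

lemma proj_eq_The_same_moments:
  "proj x0 h J k A f = (THE g. g \<in> pw_poly x0 h (mesh_cells J A) k \<and>
                              (\<forall>i\<in>mesh_cells J A. same_moments x0 h k f i g))"
  by (simp add: proj_def same_moments_def ref_coord_def)

text \<open>
  Reduces the quantification over the whole test space to its spanning Legendre polynomials, for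
  which the orthogonality relations are available.
\<close>

lemma ball_proj_tests_iff:
  fixes F :: "real poly \<Rightarrow> real"
  assumes lin: "\<And>c. F (\<Sum>l\<in>{..k} - {1}. smult (c l) (legendre l))
                   = (\<Sum>l\<in>{..k} - {1}. c l * F (legendre l))"
    and lin': "\<And>c. G (\<Sum>l\<in>{..k} - {1}. smult (c l) (legendre l))
                   = (\<Sum>l\<in>{..k} - {1}. c l * G (legendre l))"
  shows "(\<forall>v\<in>proj_tests k. F v = G v) \<longleftrightarrow> (\<forall>l\<in>{..k} - {1}. F (legendre l) = G (legendre l))"
proof (intro iffI ballI)
  fix l assume l: "l \<in> {..k} - {1}" and eq: "\<forall>v\<in>proj_tests k. F v = G v"
  have "legendre l = (\<Sum>m\<in>{..k} - {1}. if m = l then legendre m else 0)"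
    using l by (simp add: sum.delta)
  also have "\<dots> = (\<Sum>m\<in>{..k} - {1}. smult (if m = l then 1 else 0) (legendre m))"
    by (intro sum.cong) auto
  finally have "legendre l \<in> proj_tests k"
    unfolding proj_tests_def
    by (intro CollectI exI [of _ "\<lambda>m. if m = l then 1 else 0"] conjI TrueI)
  then show "F (legendre l) = G (legendre l)" using eq by blast
next
  fix v assume "v \<in> proj_tests k" and eq: "\<forall>l\<in>{..k} - {1}. F (legendre l) = G (legendre l)"
  then obtain c where "v = (\<Sum>l\<in>{..k} - {1}. smult (c l) (legendre l))"
    unfolding proj_tests_def by blast
  then show "F v = G v" using eq by (simp only: lin lin' cong: sum.cong)
qed

lemma moment_expansion:
  fixes f :: "real \<Rightarrow> real"
  assumes "f absolutely_integrable_on cell x0 h i"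
  shows "integral (cell x0 h i) (\<lambda>x. f x * poly (\<Sum>l\<in>T. smult (a l) (q l)) (ref_coord x0 h i x))
         = (\<Sum>l\<in>T. a l * integral (cell x0 h i) (\<lambda>x. f x * poly (q l) (ref_coord x0 h i x)))"
proof (cases "finite T")
  case True
  have eq: "(\<lambda>x. f x * poly (\<Sum>l\<in>T. smult (a l) (q l)) (ref_coord x0 h i x))
        = (\<lambda>x. \<Sum>l\<in>T. a l * (f x * poly (q l) (ref_coord x0 h i x)))"
    by (simp add: poly_sum sum_distrib_left mult_ac)
  have "integral (cell x0 h i) (\<lambda>x. f x * poly (\<Sum>l\<in>T. smult (a l) (q l)) (ref_coord x0 h i x))
        = (\<Sum>l\<in>T. integral (cell x0 h i) (\<lambda>x. a l * (f x * poly (q l) (ref_coord x0 h i x))))"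
    unfolding eq using True assms
    by (intro integral_sum integrable_on_mult_right integrable_mult_ref_poly)
  then show ?thesis by simp
qed simp

text \<open>
  The change of variables to \<open>\<xi>\<close> scales every integral by \<open>h / 2\<close>, and turns the conditions on a cell
  into exactly those of the unisolvence result above.
\<close>

lemma same_moments_ref_poly_iff:
  assumes h: "h > 0" and f: "f absolutely_integrable_on cell x0 h i"
    and g: "\<And>x. x \<in> cell x0 h i \<Longrightarrow> g x = poly p (ref_coord x0 h i x)"
  shows "same_moments x0 h k f i g \<longleftrightarrow>
           poly_integral (-1) 0 p = 2 / h * integral (left_half x0 h i) f \<and>
           (\<forall>l\<in>{..k} - {1}. poly_integral (-1) 1 (p * legendre l) =
              2 / h * integral (cell x0 h i) (\<lambda>x. f x * poly (legendre l) (ref_coord x0 h i x)))"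
proof -
  have "integral (left_half x0 h i) g = integral (left_half x0 h i) (\<lambda>x. poly p (ref_coord x0 h i x))"
    using g left_half_subset_cell [OF h, of x0 i] by (intro integral_cong) auto
  then have left: "integral (left_half x0 h i) g = h / 2 * poly_integral (-1) 0 p"
    using h by (simp add: integral_left_half_ref_poly)
  have "integral (cell x0 h i) (\<lambda>x. g x * poly v (ref_coord x0 h i x))
        = integral (cell x0 h i) (\<lambda>x. poly (p * v) (ref_coord x0 h i x))" for v
    using g by (intro integral_cong) auto
  then have moment: "integral (cell x0 h i) (\<lambda>x. g x * poly v (ref_coord x0 h i x)) = h / 2 * poly_integral (-1) 1 (p * v)" for v
    using h by (simp add: integral_cell_ref_poly del: poly_mult)
  have "(\<forall>v\<in>proj_tests k. h / 2 * poly_integral (-1) 1 (p * v)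
             = integral (cell x0 h i) (\<lambda>x. f x * poly v (ref_coord x0 h i x)))
        \<longleftrightarrow> (\<forall>l\<in>{..k} - {1}. h / 2 * poly_integral (-1) 1 (p * legendre l)
             = integral (cell x0 h i) (\<lambda>x. f x * poly (legendre l) (ref_coord x0 h i x)))"
    by (intro ball_proj_tests_iff moment_expansion f)
       (simp add: sum_distrib_left poly_integral_sum poly_integral_smult mult_ac)
  then show ?thesis
    unfolding same_moments_def left moment using h by (simp add: field_simps)
qed

lemma pw_poly_ref_poly_iff:
  assumes "h > 0"
  shows "g \<in> pw_poly x0 h S k \<longleftrightarrow>
     (\<forall>i\<in>S. \<exists>p. degree p \<le> k \<and> (\<forall>x\<in>cell x0 h i. g x = poly p (ref_coord x0 h i x))) \<and>
     (\<forall>x. x \<notin> (\<Union>i\<in>S. cell x0 h i) \<longrightarrow> g x = 0)"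
proof -
  have "(\<exists>q. degree q \<le> k \<and> (\<forall>x\<in>cell x0 h i. g x = poly q x)) \<longleftrightarrow>
        (\<exists>p. degree p \<le> k \<and> (\<forall>x\<in>cell x0 h i. g x = poly p (ref_coord x0 h i x)))"
    (is "?L \<longleftrightarrow> ?R") for i
  proof
    assume ?L
    then obtain q where "degree q \<le> k" "\<forall>x\<in>cell x0 h i. g x = poly q x" by blast
    with assms show ?R
      by (intro exI [of _ "pcompose q [:gpt x0 h i, h / 2:]"])
         (simp add: degree_pcompose poly_pcompose ref_coord_def field_simps)
  next
    assume ?R
    then obtain p where "degree p \<le> k"
      "\<forall>x\<in>cell x0 h i. g x = poly p (ref_coord x0 h i x)" by blast
    with assms show ?L
      by (intro exI [of _ "pcompose p [:- (2 * gpt x0 h i / h), 2 / h:]"])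
         (simp add: degree_pcompose poly_pcompose ref_coord_def field_simps)
  qed
  then show ?thesis unfolding pw_poly_def by auto
qed

text \<open>
  Overlapping cells have indices that differ by at most 1, whereas indices in one mesh have the same
  parity.
\<close>

lemma cells_of_mesh_disjoint:
  assumes "h > 0" "i \<in> mesh_cells J A" "j \<in> mesh_cells J A"
    and "x \<in> cell x0 h i" "x \<in> cell x0 h j"
  shows "i = j"
proof -
  have "of_int i * h < of_int (j + 2) * h" "of_int j * h < of_int (i + 2) * h"
    using assms(4,5) by (auto simp: cell_def gpt_def field_simps)
  with \<open>h > 0\<close> have "real_of_int i < of_int (j + 2)" "real_of_int j < of_int (i + 2)"
    by (auto simp: mult_less_cancel_right)
  then have "i < j + 2" "j < i + 2" unfolding of_int_less_iff .
  moreover have "even i \<longleftrightarrow> even j" using assms(2,3) by (cases A) auto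
  ultimately show ?thesis by presburger
qed

section \<open>The projection\<close>

text \<open>
  Since the cells of one mesh are disjoint, the cellwise solutions of the reference problem can be
  glued, and each piece is determined separately.
\<close>

lemma proj_well_posed:
  fixes f :: "real \<Rightarrow> real"
  assumes h: "h > 0" and k: "k \<ge> 1"
    and f: "\<And>i. i \<in> mesh_cells J A \<Longrightarrow> f absolutely_integrable_on cell x0 h i"
  shows "\<exists>!g. g \<in> pw_poly x0 h (mesh_cells J A) k \<and> (\<forall>i\<in>mesh_cells J A. same_moments x0 h k f i g)"
proof -
  let ?S = "mesh_cells J A"
  define R where "R i p \<longleftrightarrow> degree p \<le> k \<and>
      poly_integral (-1) 0 p = 2 / h * integral (left_half x0 h i) f \<and>
      (\<forall>l\<in>{..k} - {1}. poly_integral (-1) 1 (p * legendre l) =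
         2 / h * integral (cell x0 h i) (\<lambda>x. f x * poly (legendre l) (ref_coord x0 h i x)))" for i p
  define P where "P i = (THE p. R i p)" for i
  have ex1: "\<exists>!p. R i p" for i
    unfolding R_def by (rule reference_unisolvence [OF k])
  have P: "R i (P i)" for i
    unfolding P_def by (rule theI' [OF ex1])
  have P_unique: "p = P i" if "R i p" for p i
    using ex1 P that by blast
  \<comment> \<open>The choice of \<open>i\<close> is harmless: by disjointness only one cell contains \<open>x\<close>.\<close>
  define g where
    "g x = (if \<exists>i\<in>?S. x \<in> cell x0 h i
            then let i = (SOME i. i \<in> ?S \<and> x \<in> cell x0 h i) in poly (P i) (ref_coord x0 h i x) else 0)" for x
  have g: "g x = poly (P i) (ref_coord x0 h i x)" if "i \<in> ?S" "x \<in> cell x0 h i" for i x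
  proof -
    have "(SOME i. i \<in> ?S \<and> x \<in> cell x0 h i) = i"
      using that cells_of_mesh_disjoint [OF h] by (intro some_equality) auto
    then show ?thesis using that by (auto simp: g_def)
  qed
  have g0: "g x = 0" if "x \<notin> (\<Union>i\<in>?S. cell x0 h i)" for x
    using that by (auto simp: g_def)
  show ?thesis
  proof (rule ex1I [of _ g], intro conjI ballI)
    have "\<exists>p. degree p \<le> k \<and> (\<forall>x\<in>cell x0 h i. g x = poly p (ref_coord x0 h i x))"
      if "i \<in> ?S" for i
      using P [of i] g [OF that] unfolding R_def by (intro exI [of _ "P i"]) blast
    then show "g \<in> pw_poly x0 h ?S k"
      unfolding pw_poly_ref_poly_iff [OF h] using g0 by blast
  next
    fix i assume "i \<in> ?S"
    then show "same_moments x0 h k f i g"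
      using P [of i] unfolding R_def by (subst same_moments_ref_poly_iff [OF h f g]) blast+
  next
    fix g' assume g': "g' \<in> pw_poly x0 h ?S k \<and> (\<forall>i\<in>?S. same_moments x0 h k f i g')"
    show "g' = g"
    proof
      fix x
      show "g' x = g x"
      proof (cases "x \<in> (\<Union>i\<in>?S. cell x0 h i)")
        case True
        then obtain i where i: "i \<in> ?S" "x \<in> cell x0 h i" by blast
        then obtain p where p: "degree p \<le> k" "\<And>y. y \<in> cell x0 h i \<Longrightarrow> g' y = poly p (ref_coord x0 h i y)"
          using g' unfolding pw_poly_ref_poly_iff [OF h] by blast
        have "R i p"
          unfolding R_def
          using g' i(1) p(1) same_moments_ref_poly_iff [OF h f [OF i(1)] p(2), of k] by blast
        then show ?thesis using P_unique [of i p] p(2) [OF i(2)] g [OF i] by simp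
      next
        case False
        then show ?thesis using g' g0 unfolding pw_poly_ref_poly_iff [OF h] by metis
      qed
    qed
  qed
qed

lemma pw_poly_cmult:
  assumes "g \<in> pw_poly x0 h S k"
  shows "(\<lambda>x. c * g x) \<in> pw_poly x0 h S k"
proof -
  have "\<exists>q'. degree q' \<le> k \<and> (\<forall>x\<in>cell x0 h i. c * g x = poly q' x)"
    if "degree q \<le> k" "\<forall>x\<in>cell x0 h i. g x = poly q x" for i q
    using that by (intro exI [of _ "smult c q"]) (auto intro: order.trans [OF degree_smult_le])
  then show ?thesis using assms unfolding pw_poly_def by fastforce
qed

lemma same_moments_cmult:
  "same_moments x0 h k f i g \<Longrightarrow> same_moments x0 h k (\<lambda>x. c * f x) i (\<lambda>x. c * g x)"
  by (simp add: same_moments_def mult.assoc)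

text \<open>
  The multiple of the projection satisfies the defining conditions for the multiple of the function;
  well-posedness makes it the projection. The case \<open>c = 0\<close> serves the momentum, which vanishes at
  rest, and \<open>c = 1 / (\<gamma> - 1)\<close> serves the energy.
\<close>

lemma proj_cmult:
  fixes f :: "real \<Rightarrow> real"
  assumes h: "h > 0" and k: "k \<ge> 1"
    and f: "\<And>i. i \<in> mesh_cells J A \<Longrightarrow> f absolutely_integrable_on cell x0 h i"
  shows "proj x0 h J k A (\<lambda>x. c * f x) = (\<lambda>x. c * proj x0 h J k A f x)"
proof -
  let ?spec = "\<lambda>f g. g \<in> pw_poly x0 h (mesh_cells J A) k \<and>
                    (\<forall>i\<in>mesh_cells J A. same_moments x0 h k f i g)"
  have "\<exists>!g. ?spec f g"
    using assms by (rule proj_well_posed)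
  then have "?spec f (proj x0 h J k A f)"
    unfolding proj_eq_The_same_moments by (rule theI')
  then have "?spec (\<lambda>x. c * f x) (\<lambda>x. c * proj x0 h J k A f x)"
    by (blast intro: pw_poly_cmult same_moments_cmult)
  moreover have "\<exists>!g. ?spec (\<lambda>x. c * f x) g"
  proof (rule proj_well_posed [OF h k])
    show "(\<lambda>x. c * f x) absolutely_integrable_on cell x0 h i" if "i \<in> mesh_cells J A" for i
      using f [OF that] by (rule set_integrable_mult_right)
  qed
  ultimately show ?thesis
    unfolding proj_eq_The_same_moments [of x0 h J k A "\<lambda>x. c * f x"] by (intro the1_equality)
qed

section \<open>The scheme at the steady state\<close>

text \<open>
  On each cell the polynomial piece of \<open>f\<close> may itself be used as test polynomial, so its square has
  integral 0. Hence a tested identity determines an element of the space.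
\<close>

lemma pw_poly_eq_0:
  assumes h: "h > 0" and f: "f \<in> pw_poly x0 h S k"
    and orth: "\<And>i v. i \<in> S \<Longrightarrow> degree v \<le> k \<Longrightarrow> integral (cell x0 h i) (\<lambda>x. poly v x * f x) = 0"
  shows "f = (\<lambda>x. 0)"
proof
  fix x
  show "f x = 0"
  proof (cases "x \<in> (\<Union>i\<in>S. cell x0 h i)")
    case True
    then obtain i where i: "i \<in> S" "x \<in> cell x0 h i" by blast
    with f obtain q where q: "degree q \<le> k" "\<forall>y\<in>cell x0 h i. f y = poly q y"
      unfolding pw_poly_def by blast
    have "poly_integral (gpt x0 h (i - 1)) (gpt x0 h (i + 1)) (q * q)
          = integral (cell x0 h i) (\<lambda>y. poly q y * poly q y)"
      by (simp add: poly_integral_def cell_def integral_open_interval_real flip: poly_mult)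
    also have "\<dots> = integral (cell x0 h i) (\<lambda>y. poly q y * f y)"
      using q(2) by (intro integral_cong) simp
    also have "\<dots> = 0" using orth i q by blast
    finally have "q = 0"
      using h by (intro poly_integral_square_eq_0) (auto simp: gpt_def field_simps)
    then show ?thesis using q i by simp
  next
    case False
    with f show ?thesis unfolding pw_poly_def by blast
  qed
qed

lemma vector_pw_poly_eq_0:
  fixes G :: "real \<Rightarrow> real^'n"
  assumes h: "h > 0" and G: "\<And>c. (\<lambda>x. G x $ c) \<in> pw_poly x0 h S k"
    and orth: "\<And>i v. i \<in> S \<Longrightarrow> degree v \<le> k \<Longrightarrow> integral (cell x0 h i) (\<lambda>x. poly v x *\<^sub>R G x) = 0"
  shows "G = (\<lambda>x. 0)"
proof -
  have "(\<lambda>x. G x $ c) = (\<lambda>x. 0)" for c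
  proof (rule pw_poly_eq_0 [OF h G])
    fix i and v :: "real poly" assume iv: "i \<in> S" "degree v \<le> k"
    have "(\<lambda>x. poly v x *\<^sub>R G x) integrable_on cell x0 h i"
    proof (rule integrable_componentwise)
      fix b :: "real^'n" assume "b \<in> Basis"
      then obtain d where b: "b = axis d 1" by (auto simp: Basis_vec_def)
      obtain q where q: "\<forall>x\<in>cell x0 h i. G x $ d = poly q x"
        using G [of d] iv(1) unfolding pw_poly_def by blast
      have "poly (v * q) integrable_on cell x0 h i"
        using poly_integrable by (simp add: cell_def flip: integrable_on_Icc_iff_Ioo)
      then show "(\<lambda>x. (poly v x *\<^sub>R G x) \<bullet> b) integrable_on cell x0 h i"
        by (rule integrable_eq) (simp add: b inner_axis q)
    qed
    then have "integral (cell x0 h i) (\<lambda>x. (poly v x *\<^sub>R G x) $ c)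
               = integral (cell x0 h i) (\<lambda>x. poly v x *\<^sub>R G x) $ c"
      by (rule integral_component_eq_cart)
    then show "integral (cell x0 h i) (\<lambda>x. poly v x * G x $ c) = 0"
      using orth [OF iv] by simp
  qed
  then show ?thesis by (simp add: fun_eq_iff vec_eq_iff)
qed

lemma quad_add_eq_0:
  assumes "\<And>\<kappa> z. \<kappa> \<in> {1, 2} \<Longrightarrow> z \<in> gauss_nodes N \<Longrightarrow>
             f (quad_pt x0 h i \<kappa> z) + g (quad_pt x0 h i \<kappa> z) = 0"
  shows "quad x0 h N i f + quad x0 h N i g = 0"
proof -
  have "quad x0 h N i g = - quad x0 h N i f"
    unfolding quad_def scaleR_minus_right [symmetric] sum_negf [symmetric]
    using assms by (intro arg_cong [of _ _ "scaleR (h / 2)"] sum.cong refl)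
       (metis add_eq_0_iff scaleR_minus_right)
  then show ?thesis by simp
qed

text \<open>
  The nonzero average guarantees that \<open>R\<close> is integrable, as the integral would otherwise be 0 by
  convention.
\<close>

lemma cell_avg_scaleR_axis:
  fixes R :: "real \<Rightarrow> real" and e :: "'a::euclidean_space"
  assumes "cell_avg x0 h i R \<noteq> 0"
  shows "cell_avg x0 h i (\<lambda>x. R x *\<^sub>R e) = cell_avg x0 h i R *\<^sub>R e"
proof -
  have "R integrable_on cell x0 h i"
    using assms not_integrable_integral by (fastforce simp: cell_avg_def)
  then have "integral (cell x0 h i) (\<lambda>x. R x *\<^sub>R e) = integral (cell x0 h i) R *\<^sub>R e"
    by (intro integral_unique has_integral_scaleR_left integrable_integral)
  then show ?thesis by (simp add: cell_avg_def)
qed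

text \<open>
  With velocity 0, flux and source act on the momentum only, i.e. along the unit vector \<open>e\<close>. The
  ratio of \<open>Qvec\<close> to the density is \<open>e\<close> both at the nodes and for the averages, so the correction
  term of the source drops out and its boundary and volume terms in the pressure remain. The flux
  contributes the same terms with opposite signs. The relaxation terms cancel because the data
  coincide with the reference state.
\<close>

lemma cdg_rhs_steady_eq_0:
  fixes J A
  defines "B \<equiv> other A"
  assumes \<gamma>: "\<gamma> > 1"
    and mom: "proj x0 h J k B (\<lambda>x. 0) = (\<lambda>x. 0)"
    and energy: "proj x0 h J k B (\<lambda>x. ps x / (\<gamma> - 1)) = (\<lambda>x. proj x0 h J k B ps x / (\<gamma> - 1))"
    and pos: "\<And>x. x \<in> eval_pts x0 h N i \<Longrightarrow> proj x0 h J k B \<rho>s x > 0"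
    and avg: "cell_avg x0 h i (proj x0 h J k B \<rho>s) > 0"
  shows "cdg_rhs x0 h J k N \<gamma> \<tau> \<rho>s ps A (proj_vec x0 h J k A (steady_state \<gamma> \<rho>s ps))
           (proj_vec x0 h J k B (steady_state \<gamma> \<rho>s ps)) i v = 0"
proof -
  define R where "R = proj x0 h J k B \<rho>s"
  define P where "P = proj x0 h J k B ps"
  define UA where "UA = proj_vec x0 h J k A (steady_state \<gamma> \<rho>s ps)"
  define UB where "UB = proj_vec x0 h J k B (steady_state \<gamma> \<rho>s ps)"
  define e :: "real^3" where "e = axis 2 1"
  have UB: "UB x = vector [R x, 0, P x / (\<gamma> - 1)]" for x
    unfolding UB_def proj_vec_def steady_state_def
    by (simp add: vec_eq_iff forall_3 mom energy R_def P_def)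
  have flux: "flux \<gamma> (UB x) = P x *\<^sub>R e" for x
    using \<gamma> by (simp add: UB flux_def velocity_def pressure_def e_def vec_eq_iff forall_3 axis_def)
  have Q: "Qvec (UB x) = R x *\<^sub>R e" for x
    by (simp add: UB Qvec_def e_def vec_eq_iff forall_3 axis_def)
  have q: "(1 / cell_avg x0 h i R) *\<^sub>R cell_avg x0 h i (\<lambda>x. Qvec (UB x)) = e"
    using avg by (simp add: Q cell_avg_scaleR_axis R_def)
  have "integral (cell x0 h i) (\<lambda>x. poly v x *\<^sub>R (UA x - UB x))
        = integral (cell x0 h i) (\<lambda>x. - (poly v x *\<^sub>R (UB x - UA x)))"
    by (simp add: scaleR_diff_right)
  then have relax: "(1 / \<tau>) *\<^sub>R integral (cell x0 h i) (\<lambda>x. poly v x *\<^sub>R (UB x - UA x))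
             + (1 / \<tau>) *\<^sub>R integral (cell x0 h i) (\<lambda>x. poly v x *\<^sub>R (UA x - UB x)) = 0"
    by simp
  have quads: "quad x0 h N i (\<lambda>x. poly (pderiv v) x *\<^sub>R flux \<gamma> (UB x)) +
        quad x0 h N i (\<lambda>x. (deriv P x * poly v x) *\<^sub>R ((1 / R x) *\<^sub>R Qvec (UB x) - e)
                            - (P x * poly (pderiv v) x) *\<^sub>R e) = 0"
  proof (rule quad_add_eq_0)
    fix \<kappa> :: nat and z assume "\<kappa> \<in> {1, 2}" "z \<in> gauss_nodes N"
    then have "R (quad_pt x0 h i \<kappa> z) > 0"
      unfolding R_def by (intro pos) (auto simp: eval_pts_def)
    then show "poly (pderiv v) (quad_pt x0 h i \<kappa> z) *\<^sub>R flux \<gamma> (UB (quad_pt x0 h i \<kappa> z)) +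
       ((deriv P (quad_pt x0 h i \<kappa> z) * poly v (quad_pt x0 h i \<kappa> z)) *\<^sub>R
          ((1 / R (quad_pt x0 h i \<kappa> z)) *\<^sub>R Qvec (UB (quad_pt x0 h i \<kappa> z)) - e)
        - (P (quad_pt x0 h i \<kappa> z) * poly (pderiv v) (quad_pt x0 h i \<kappa> z)) *\<^sub>R e) = 0"
      by (simp add: flux Q)
  qed
  have "cdg_rhs x0 h J k N \<gamma> \<tau> \<rho>s ps A UA UB i v =
      ((1 / \<tau>) *\<^sub>R integral (cell x0 h i) (\<lambda>x. poly v x *\<^sub>R (UB x - UA x))
       + (1 / \<tau>) *\<^sub>R integral (cell x0 h i) (\<lambda>x. poly v x *\<^sub>R (UA x - UB x)))
      + (quad x0 h N i (\<lambda>x. poly (pderiv v) x *\<^sub>R flux \<gamma> (UB x)) +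
        quad x0 h N i (\<lambda>x. (deriv P x * poly v x) *\<^sub>R ((1 / R x) *\<^sub>R Qvec (UB x) - e)
                            - (P x * poly (pderiv v) x) *\<^sub>R e))"
    unfolding cdg_rhs_def source_def Let_def UA_def [symmetric] B_def [symmetric]
      UB_def [symmetric] R_def [symmetric] P_def [symmetric] q
    unfolding flux [of "gpt _ _ _"] by (simp add: algebra_simps)
  then show ?thesis
    unfolding UA_def [symmetric] UB_def [symmetric] relax quads by simp
qed

lemma cell_subset_mesh_domain:
  assumes "i \<in> J"
  shows "cell x0 h i \<subseteq> mesh_domain x0 h J"
  unfolding mesh_domain_def cell_def
  using assms by (intro interior_maximal) (force simp: less_imp_le)+

theorem theorem3p1:
  fixes x0 h \<gamma> \<tau> :: real
    and J :: "int set"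
    and k N :: nat
    and \<phi> \<rho>s ps :: "real \<Rightarrow> real"
  assumes "h > 0" and "\<gamma> > 1" and "\<tau> > 0" and "k \<ge> 1" and "N \<ge> k + 1"
    and hydro: "hydrostatic (mesh_domain x0 h J) \<phi> \<rho>s ps"
    and integrable: "\<And>i. i \<in> J \<Longrightarrow> \<rho>s integrable_on cell x0 h i \<and> ps integrable_on cell x0 h i"
    and pos_points: "\<And>A i x. i \<in> inner_cells J A \<Longrightarrow> x \<in> eval_pts x0 h N i \<Longrightarrow>
                       proj x0 h J k (other A) \<rho>s x > 0"
    and pos_avg: "\<And>A i. i \<in> inner_cells J A \<Longrightarrow>
                       cell_avg x0 h i (proj x0 h J k (other A) \<rho>s) > 0"
  shows "well_balanced x0 h J k N \<gamma> \<tau> \<rho>s ps"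
proof -
  have ps: "ps absolutely_integrable_on cell x0 h i" if "i \<in> mesh_cells J A" for i A
  proof (rule nonnegative_absolutely_integrable_1)
    have "i \<in> J" using that by (cases A) auto
    then show "ps integrable_on cell x0 h i" using integrable by blast
    show "0 \<le> ps x" if "x \<in> cell x0 h i" for x
      using hydro cell_subset_mesh_domain [OF \<open>i \<in> J\<close>] that less_imp_le
      unfolding hydrostatic_def by blast
  qed
  have scale: "proj x0 h J k A (\<lambda>x. c * ps x) = (\<lambda>x. c * proj x0 h J k A ps x)" for A c
    using \<open>h > 0\<close> \<open>k \<ge> 1\<close> ps by (rule proj_cmult)
  have rhs: "cdg_rhs x0 h J k N \<gamma> \<tau> \<rho>s ps A (proj_vec x0 h J k A (steady_state \<gamma> \<rho>s ps))
      (proj_vec x0 h J k (other A) (steady_state \<gamma> \<rho>s ps)) i v = 0"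
    if "i \<in> inner_cells J A" for A i v
    using \<open>\<gamma> > 1\<close> scale [of "other A" 0] scale [of "other A" "1 / (\<gamma> - 1)"]
      pos_points [OF that] pos_avg [OF that]
    by (intro cdg_rhs_steady_eq_0) simp_all
  have op: "cdg_op x0 h J k N \<gamma> \<tau> \<rho>s ps A (proj_vec x0 h J k A (steady_state \<gamma> \<rho>s ps))
      (proj_vec x0 h J k (other A) (steady_state \<gamma> \<rho>s ps)) = (\<lambda>x. 0)" for A
    unfolding cdg_op_def
  proof (rule the_equality, goal_cases)
    case 1
    have "(\<lambda>x. 0) \<in> pw_poly x0 h (inner_cells J A) k"
      unfolding pw_poly_def by (auto intro: exI [of _ 0])
    then show ?case by (simp add: rhs)
  next
    case (2 G)
    then show ?case
      using \<open>h > 0\<close> by (intro vector_pw_poly_eq_0) (auto simp: rhs)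
  qed
  show ?thesis
    using op [of Primal] op [of Dual] by (simp add: well_balanced_def Let_def)
qed

end
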